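(* Let $\{T_n,n\ge1\}$ be a sequence of independent and identically distributed random variables with common cdf $F$, the cdf of the finite mixed skew-$t$ distribution with parameters $0<v_1<\dots<v_r$, $\beta_i\in\mathbb{R}$, $p_i>0$, $\sum_{i=1}^rp_i=1$. Let $M_n=\max_{1\le k\le n}T_k$. Then for every $x>0$, $$\lim_{n\to\infty}\mathrm{P}(M_n\le a_nx)=\lim_{n\to\infty}F^n(a_nx)=\exp(-x^{-v_1}),$$ where $$a_n=\big(2p_1C_{v_1}T_{v_1+1}(\beta_1\sqrt{v_1+1})\big)^{\frac1{v_1}}v_1^{\frac{v_1-1}{2v_1}}n^{\frac1{v_1}}.$$
   Context: Student $t$: for $v>0$, $t_v(x)=C_v(1+x^2/v)^{-(v+1)/2}$ with $C_v=\frac{\Gamma((v+1)/2)}{\Gamma(v/2)\sqrt{v\pi}}$ is the pdf, and $T_v$ is the cdf, of the standard Student $t$ distribution with $v$ degrees of freedom. Skew-$t$: $\mathrm{ST}_v(\beta)$ ($v>0$, $\beta\in\mathbb{R}$) is the distribution on $\mathbb{R}$ with pdf $2t_v(x)T_{v+1}\big(\beta x\sqrt{\tfrac{v+1}{x^2+v}}\big)$; its cdf is denoted $F_{v,\beta}$. Mixed skew-$t$ distribution with $r$ components: given $0<v_1<v_2<\dots<v_r$, $\beta_i\in\mathbb{R}$, $p_i>0$ with $\sum_{i=1}^rp_i=1$, it is the distribution with cdf $F(x)=\sum_{i=1}^rp_iF_{v_i,\beta_i}(x)$. *)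

theory Defs
  imports "HOL-Probability.Probability"
begin

text \<open>
  The degrees of freedom \<open>v\<close> are meant to be positive throughout; for \<open>v \<le> 0\<close> the
  constants below carry no meaning.
\<close>

definition student_t_const :: "real \<Rightarrow> real" where
  "student_t_const v = Gamma ((v + 1) / 2) / (Gamma (v / 2) * sqrt (v * pi))"

definition student_t_density :: "real \<Rightarrow> real \<Rightarrow> real" where
  "student_t_density v x = student_t_const v * (1 + x\<^sup>2 / v) powr (- ((v + 1) / 2))"

definition student_t :: "real \<Rightarrow> real measure" where
  "student_t v = density lborel (\<lambda>x. ennreal (student_t_density v x))"

abbreviation student_t_cdf :: "real \<Rightarrow> real \<Rightarrow> real" where
  "student_t_cdf v \<equiv> cdf (student_t v)"

definition skew_t_density :: "real \<Rightarrow> real \<Rightarrow> real \<Rightarrow> real" where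
  "skew_t_density v \<beta> x =
     2 * student_t_density v x * student_t_cdf (v + 1) (\<beta> * x * sqrt ((v + 1) / (x\<^sup>2 + v)))"

definition skew_t :: "real \<Rightarrow> real \<Rightarrow> real measure" where
  "skew_t v \<beta> = density lborel (\<lambda>x. ennreal (skew_t_density v \<beta> x))"

abbreviation skew_t_cdf :: "real \<Rightarrow> real \<Rightarrow> real \<Rightarrow> real" where
  "skew_t_cdf v \<beta> \<equiv> cdf (skew_t v \<beta>)"

text \<open>The components are indexed by \<open>1, \<dots>, r\<close>; values of \<open>v\<close>, \<open>\<beta>\<close>, \<open>p\<close> outside this range
  are irrelevant.\<close>

definition mixed_skew_t_cdf ::
    "nat \<Rightarrow> (nat \<Rightarrow> real) \<Rightarrow> (nat \<Rightarrow> real) \<Rightarrow> (nat \<Rightarrow> real) \<Rightarrow> real \<Rightarrow> real" where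
  "mixed_skew_t_cdf r v \<beta> p x = (\<Sum>i = 1..r. p i * skew_t_cdf (v i) (\<beta> i) x)"

end

theory Submission
  imports Defs "HOL-Real_Asymp.Real_Asymp"
begin

text \<open>
  The maximum of \<open>n\<close> independent variables with distribution function \<open>F\<close> has distribution
  function \<open>F ^ n\<close>, so everything rests on how fast \<open>1 - F\<close> decays. If
  \<open>y powr v * (1 - F y)\<close> tends to \<open>A > 0\<close> and \<open>b n = (A * n) powr (1 / v)\<close>, then
  \<open>n * (1 - F (b n * x))\<close> tends to \<open>x powr (- v)\<close>, and a Poisson-type limit gives
  \<open>F (b n * x) ^ n \<longlonglongrightarrow> exp (- (x powr (- v)))\<close>: this is \<open>powr_tail_imp_Frechet_limit\<close>.

  The tail of the mixture comes from its densities. The Student density behaves like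
  \<open>student_t_const v * v powr ((v + 1) / 2) * y powr (- (v + 1))\<close> at infinity, while the argument
  \<open>\<beta> * y * sqrt ((v + 1) / (y\<^sup>2 + v))\<close> of the skewing factor converges to
  \<open>\<beta> * sqrt (v + 1)\<close>. So the skew-t density is asymptotic to a constant times
  \<open>y powr (- (v + 1))\<close>, and integrating a comparison of densities (\<open>density_tail_asymp\<close>) turns
  this into a tail asymptotic to a constant times \<open>y powr (- v)\<close>. In the mixture the component
  with the smallest \<open>v\<close>, which is the first, has the heaviest tail; multiplied by
  \<open>y powr v 1\<close>, the tails of the others vanish in the limit
  (\<open>mixed_skew_t_tail_asymp\<close>). The resulting constant is \<open>A\<close>, and \<open>(A * n) powr (1 / v 1)\<close>
  is the normalizing sequence of the theorem.

  To pass from \<open>F\<close> to the tails of its components, let \<open>m i\<close> be the total mass of the \<open>i\<close>-th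
  component. Since \<open>F\<close> is the distribution function of a random variable, it tends to 1, while the
  mixture tends to \<open>\<Sum>i = 1..r. p i * m i\<close>. So this sum equals 1, and subtracting \<open>F\<close> from
  it leaves the weighted sum of the component tails (\<open>mixed_skew_t_survival\<close>).
\<close>

section \<open>Tails of densities with a power decay\<close>

text \<open>
  The comparison integral, over an open half-line because that is the complement of the set
  \<open>{..x}\<close> measured by a distribution function.
\<close>

lemma nn_integral_powr_tail:
  fixes v x c :: real
  assumes v: "0 < v" and x: "0 < x" and c: "0 \<le> c"
  shows "(\<integral>\<^sup>+y. ennreal (c * y powr (- (v + 1))) * indicator {x<..} y \<partial>lborel)
       = ennreal (c / v * x powr (- v))"
proof -
  have "(\<integral>\<^sup>+y. ennreal (c * y powr (- (v + 1))) * indicator {x<..} y \<partial>lborel)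
      = (\<integral>\<^sup>+y. ennreal (c * y powr (- (v + 1))) * indicator {x..} y \<partial>lborel)"
    using AE_lborel_singleton[of x]
    by (intro nn_integral_cong_AE) (auto split: split_indicator elim!: eventually_mono)
  also have "\<dots> = ennreal (0 - (- (c / v * x powr (- v))))"
  proof (rule nn_integral_FTC_atLeast)
    show "((\<lambda>y. - (c / v * y powr (- v))) has_real_derivative c * y powr (- (v + 1))) (at y)"
      if "x \<le> y" for y
    proof -
      have "((\<lambda>y. - (c / v * y powr (- v))) has_real_derivative
          - (c / v * (- v * y powr (- v - 1)))) (at y)"
        using that x by (intro DERIV_minus DERIV_cmult has_real_derivative_powr) simp
      also have "- v - 1 = - (v + 1)" by simp
      also have "- (c / v * (- v * y powr (- (v + 1)))) = c * y powr (- (v + 1))"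
        using v by simp
      finally show ?thesis .
    qed
    have "((\<lambda>y. y powr (- v)) \<longlongrightarrow> 0) at_top"
      using v by (intro tendsto_neg_powr filterlim_ident) auto
    from tendsto_mult_left[OF this, of "- (c / v)"]
    show "((\<lambda>y. - (c / v * y powr (- v))) \<longlongrightarrow> 0) at_top"
      by simp
  qed (use c in auto)
  finally show ?thesis by simp
qed

lemma emeasure_density_tail_le:
  fixes f :: "real \<Rightarrow> real"
  assumes [measurable]: "f \<in> borel_measurable borel"
    and v: "0 < v" and x: "0 < x" and c: "0 \<le> c"
    and le: "\<And>y. x < y \<Longrightarrow> f y \<le> c * y powr (- (v + 1))"
  shows "emeasure (density lborel (\<lambda>y. ennreal (f y))) {x<..} \<le> ennreal (c / v * x powr (- v))"
proof -
  have "emeasure (density lborel (\<lambda>y. ennreal (f y))) {x<..}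
      = (\<integral>\<^sup>+y. ennreal (f y) * indicator {x<..} y \<partial>lborel)"
    by (simp add: emeasure_density)
  also have "\<dots> \<le> (\<integral>\<^sup>+y. ennreal (c * y powr (- (v + 1))) * indicator {x<..} y \<partial>lborel)"
    using le by (intro nn_integral_mono) (auto intro!: ennreal_leI split: split_indicator)
  finally show ?thesis
    by (simp only: nn_integral_powr_tail[OF v x c])
qed

text \<open>
  The sign of \<open>c\<close> is arbitrary because the lemma is applied with \<open>c = K - d\<close>, where \<open>K\<close> is a
  limit that may be smaller than \<open>d\<close>.
\<close>

lemma emeasure_density_tail_ge:
  fixes f :: "real \<Rightarrow> real"
  assumes [measurable]: "f \<in> borel_measurable borel"
    and v: "0 < v" and x: "0 < x"
    and ge: "\<And>y. x < y \<Longrightarrow> c * y powr (- (v + 1)) \<le> f y"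
  shows "ennreal (c / v * x powr (- v)) \<le> emeasure (density lborel (\<lambda>y. ennreal (f y))) {x<..}"
proof (cases "0 \<le> c")
  case True
  have "ennreal (c / v * x powr (- v))
      = (\<integral>\<^sup>+y. ennreal (c * y powr (- (v + 1))) * indicator {x<..} y \<partial>lborel)"
    by (simp only: nn_integral_powr_tail[OF v x True])
  also have "\<dots> \<le> (\<integral>\<^sup>+y. ennreal (f y) * indicator {x<..} y \<partial>lborel)"
    using ge by (intro nn_integral_mono) (auto intro!: ennreal_leI split: split_indicator)
  also have "\<dots> = emeasure (density lborel (\<lambda>y. ennreal (f y))) {x<..}"
    by (simp add: emeasure_density)
  finally show ?thesis .
next
  case False
  then have "c / v * x powr (- v) \<le> 0"
    using v by (auto intro!: mult_nonpos_nonneg divide_nonpos_pos)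
  then show ?thesis by (simp add: ennreal_neg)
qed

text \<open>
  Tail integrals inherit a power asymptotic from the integrand: beyond some point the density lies
  between \<open>(K - d) * y powr (- (v + 1))\<close> and \<open>(K + d) * y powr (- (v + 1))\<close>, and both bounds
  integrate explicitly.
\<close>

lemma density_tail_asymp:
  fixes f :: "real \<Rightarrow> real"
  assumes [measurable]: "f \<in> borel_measurable borel"
    and v: "0 < v" and K: "0 \<le> K"
    and lim: "((\<lambda>y. y powr (v + 1) * f y) \<longlongrightarrow> K) at_top"
  shows "((\<lambda>x. x powr v * measure (density lborel (\<lambda>y. ennreal (f y))) {x<..}) \<longlongrightarrow> K / v) at_top"
proof (rule tendstoI)
  fix e :: real assume e: "0 < e"
  \<comment> \<open>Integration divides the error in the density by \<open>v\<close>; this choice leaves \<open>e / 2\<close>.\<close>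
  define d where "d = e * v / 2"
  have d: "0 < d" using e v by (simp add: d_def)
  obtain X where X: "\<And>y. X \<le> y \<Longrightarrow> \<bar>y powr (v + 1) * f y - K\<bar> < d"
    using tendstoD[OF lim d] by (auto simp: eventually_at_top_linorder dist_real_def)
  show "\<forall>\<^sub>F x in at_top. dist (x powr v * measure (density lborel (\<lambda>y. ennreal (f y))) {x<..}) (K / v) < e"
    using eventually_gt_at_top[of "max X 0"]
  proof eventually_elim
    fix x assume "max X 0 < x"
    then have x: "0 < x" and xX: "X < x" by auto
    let ?m = "emeasure (density lborel (\<lambda>y. ennreal (f y))) {x<..}"
    have *: "(K - d) * y powr (- (v + 1)) \<le> f y \<and> f y \<le> (K + d) * y powr (- (v + 1))" if "x < y" for y
    proof -
      have "f y = (y powr (v + 1) * f y) * y powr (- (v + 1))"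
        using x that powr_add[of y "v + 1" "- (v + 1)"] by simp
      moreover have "K - d \<le> y powr (v + 1) * f y" "y powr (v + 1) * f y \<le> K + d"
        using X[of y] xX that by auto
      ultimately show ?thesis by (metis mult_right_mono powr_ge_zero)
    qed
    have up: "?m \<le> ennreal ((K + d) / v * x powr (- v))"
      using * K d by (intro emeasure_density_tail_le v x) auto
    have lo: "ennreal ((K - d) / v * x powr (- v)) \<le> ?m"
      using * by (intro emeasure_density_tail_ge v x) auto
    have fin: "?m < top" using up by (rule le_less_trans) simp
    have m_up: "measure (density lborel (\<lambda>y. ennreal (f y))) {x<..} \<le> (K + d) / v * x powr (- v)"
      unfolding measure_def using enn2real_mono[OF up] K d v by simp
    have m_lo: "(K - d) / v * x powr (- v) \<le> measure (density lborel (\<lambda>y. ennreal (f y))) {x<..}"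
    proof (cases "0 \<le> K - d")
      case True
      then show ?thesis
        unfolding measure_def using enn2real_mono[OF lo fin] v by simp
    next
      case False
      then have "(K - d) / v * x powr (- v) \<le> 0"
        using v by (auto intro!: mult_nonpos_nonneg divide_nonpos_pos)
      then show ?thesis by (rule order_trans) simp
    qed
    have halves: "(K + d) / v = K / v + e / 2" "(K - d) / v = K / v - e / 2"
      using v by (simp_all add: d_def field_simps)
    have cancel: "x powr v * (c / v * x powr (- v)) = c / v" for c
      using x powr_add[of x v "- v"] by simp
    have "x powr v * measure (density lborel (\<lambda>y. ennreal (f y))) {x<..} \<le> K / v + e / 2"
      using mult_left_mono[OF m_up powr_ge_zero[of x v]] by (simp only: cancel halves[symmetric])
    moreover have "K / v - e / 2 \<le> x powr v * measure (density lborel (\<lambda>y. ennreal (f y))) {x<..}"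
      using mult_left_mono[OF m_lo powr_ge_zero[of x v]] by (simp only: cancel halves[symmetric])
    ultimately show "dist (x powr v * measure (density lborel (\<lambda>y. ennreal (f y))) {x<..}) (K / v) < e"
      using e unfolding dist_real_def by linarith
  qed
qed

section \<open>The Student and skew-t laws\<close>

lemma student_t_const_pos: "0 < v \<Longrightarrow> 0 < student_t_const v"
  by (auto simp: student_t_const_def intro!: divide_pos_pos mult_pos_pos Gamma_real_pos)

lemma student_t_density_pos: "0 < v \<Longrightarrow> 0 < student_t_density v x"
  using add_pos_nonneg[of 1 "x\<^sup>2 / v"] student_t_const_pos[of v]
  by (auto simp: student_t_density_def intro!: mult_pos_pos)

lemma borel_measurable_student_t_density [measurable]:
  "student_t_density v \<in> borel_measurable borel"
  unfolding student_t_density_def by measurable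

text \<open>
  With the power absorbed, the remaining factor is monotone and has a limit at infinity, so this
  form yields both a domination of the Student density and its asymptotics.
\<close>

lemma powr_times_student_t_density:
  assumes v: "0 < v" and y: "0 < y"
  shows "y powr (v + 1) * student_t_density v y
       = student_t_const v * (1 / y\<^sup>2 + 1 / v) powr (- ((v + 1) / 2))"
proof -
  have "1 + y\<^sup>2 / v = y\<^sup>2 * (1 / y\<^sup>2 + 1 / v)"
    using v y by (simp add: field_simps)
  then have "(1 + y\<^sup>2 / v) powr (- ((v + 1) / 2))
      = (y\<^sup>2) powr (- ((v + 1) / 2)) * (1 / y\<^sup>2 + 1 / v) powr (- ((v + 1) / 2))"
    using v by (simp add: powr_mult)
  moreover have "(y\<^sup>2) powr (- ((v + 1) / 2)) = y powr (- (v + 1))"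
  proof -
    have "(y\<^sup>2) powr (- ((v + 1) / 2)) = y powr (2 * - ((v + 1) / 2))"
      using y powr_powr[of y 2 "- ((v + 1) / 2)"] by simp
    also have "2 * - ((v + 1) / 2) = - (v + 1)" by (simp add: field_simps)
    finally show ?thesis .
  qed
  ultimately have "y powr (v + 1) * student_t_density v y
      = student_t_const v * ((y powr (v + 1) * y powr (- (v + 1)))
          * (1 / y\<^sup>2 + 1 / v) powr (- ((v + 1) / 2)))"
    by (simp only: student_t_density_def mult_ac)
  moreover have "y powr (v + 1) * y powr (- (v + 1)) = 1"
    using y powr_add[of y "v + 1" "- (v + 1)"] by simp
  ultimately show ?thesis
    by (simp only: mult_1)
qed

lemma student_t_density_asymp:
  assumes v: "0 < v"
  shows "((\<lambda>y. y powr (v + 1) * student_t_density v y)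
           \<longlongrightarrow> student_t_const v * v powr ((v + 1) / 2)) at_top"
proof -
  have "((\<lambda>y::real. 1 / y\<^sup>2) \<longlongrightarrow> 0) at_top"
    by real_asymp
  then have "((\<lambda>y. student_t_const v * (1 / y\<^sup>2 + 1 / v) powr (- ((v + 1) / 2)))
      \<longlongrightarrow> student_t_const v * (0 + 1 / v) powr (- ((v + 1) / 2))) at_top"
    using v by (intro tendsto_intros) auto
  moreover have "(0 + 1 / v) powr (- ((v + 1) / 2)) = v powr ((v + 1) / 2)"
    using v by (simp add: powr_minus powr_divide)
  moreover have "\<forall>\<^sub>F y in at_top. student_t_const v * (1 / y\<^sup>2 + 1 / v) powr (- ((v + 1) / 2))
      = y powr (v + 1) * student_t_density v y"
    using eventually_gt_at_top[of 0] by eventually_elim (simp add: powr_times_student_t_density v)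
  ultimately show ?thesis
    by (simp add: tendsto_cong)
qed

text \<open>
  Finiteness is what makes \<open>cdf\<close> meaningful here, since the measure of a set of infinite mass is 0
  by convention. The right tail is dominated by a power, the left tail is its mirror image, and in
  between the density is bounded by its value at 0.
\<close>

lemma finite_borel_measure_student_t:
  assumes v: "0 < v"
  shows "finite_borel_measure (student_t v)"
proof (intro finite_borel_measure.intro finite_measureI finite_borel_measure_axioms.intro)
  let ?C = "student_t_const v" and ?D = "student_t v"
  have C: "0 < ?C" by (rule student_t_const_pos[OF v])
  show "sets ?D = sets borel" by (simp add: student_t_def)
  have right: "emeasure ?D {1<..} < \<infinity>"
  proof -
    have "student_t_density v y \<le> ?C * v powr ((v + 1) / 2) * y powr (- (v + 1))" if "1 < y" for y
    proof -
      have "y powr (v + 1) * student_t_density v y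
          = ?C * (1 / y\<^sup>2 + 1 / v) powr (- ((v + 1) / 2))"
        using v that by (simp add: powr_times_student_t_density)
      also have "\<dots> \<le> ?C * (1 / v) powr (- ((v + 1) / 2))"
        using C v by (intro mult_left_mono powr_mono2') auto
      also have "\<dots> = ?C * v powr ((v + 1) / 2)"
        using v by (simp add: powr_minus powr_divide)
      finally have "y powr (- (v + 1)) * (y powr (v + 1) * student_t_density v y)
          \<le> y powr (- (v + 1)) * (?C * v powr ((v + 1) / 2))"
        by (intro mult_left_mono) auto
      moreover have "y powr (- (v + 1)) * y powr (v + 1) = 1"
        using that powr_add[of y "- (v + 1)" "v + 1"] by simp
      ultimately show ?thesis
        by (simp only: mult.assoc[symmetric] mult_1) (simp only: mult_ac)
    qed
    then have "emeasure ?D {1<..} \<le> ennreal (?C * v powr ((v + 1) / 2) / v * 1 powr (- v))"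
      unfolding student_t_def using C v by (intro emeasure_density_tail_le) auto
    then show ?thesis by (rule le_less_trans) simp
  qed
  have "emeasure ?D {..<-1} = (\<integral>\<^sup>+y. ennreal (student_t_density v y) * indicator {..<-1} y \<partial>lborel)"
    by (simp add: student_t_def emeasure_density)
  also have "\<dots> = (\<integral>\<^sup>+y. ennreal (student_t_density v y) * indicator {1<..} y \<partial>lborel)"
    by (subst nn_integral_real_affine[of _ "-1" 0])
       (auto simp: student_t_density_def intro!: nn_integral_cong split: split_indicator)
  also have "\<dots> = emeasure ?D {1<..}"
    by (simp add: student_t_def emeasure_density)
  finally have left: "emeasure ?D {..<-1} < \<infinity>" using right by simp
  have "emeasure ?D {-1..1} \<le> (\<integral>\<^sup>+y. ennreal ?C * indicator {-1..1::real} y \<partial>lborel)"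
  proof -
    have "student_t_density v y \<le> ?C" for y
      using C v powr_mono2'[of "- ((v + 1) / 2)" 1 "1 + y\<^sup>2 / v"]
      by (simp add: student_t_density_def mult_left_le)
    then show ?thesis
      by (auto simp: student_t_def emeasure_density intro!: nn_integral_mono ennreal_leI
          split: split_indicator)
  qed
  also have "\<dots> < \<infinity>"
    by (simp add: nn_integral_cmult_indicator ennreal_mult_less_top)
  finally have middle: "emeasure ?D {-1..1} < \<infinity>" .
  have "space ?D = ({..<-1} \<union> {-1..1}) \<union> {1<..}"
    by (auto simp: student_t_def)
  moreover have "emeasure ?D \<dots> \<le> emeasure ?D {..<-1} + emeasure ?D {-1..1} + emeasure ?D {1<..}"
    by (intro order_trans[OF emeasure_subadditive] add_mono emeasure_subadditive order_refl)
       (auto simp: student_t_def)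
  ultimately show "emeasure ?D (space ?D) \<noteq> \<infinity>"
    using left middle right by (auto simp: top_unique less_top[symmetric])
qed

lemma isCont_student_t_cdf:
  assumes v: "0 < v"
  shows "isCont (student_t_cdf v) x"
proof -
  interpret finite_borel_measure "student_t v"
    by (rule finite_borel_measure_student_t[OF v])
  have "AE y in lborel. y \<in> {x} \<longrightarrow> ennreal (student_t_density v y) = 0"
    using AE_lborel_singleton[of x] by eventually_elim auto
  then have "emeasure (student_t v) {x} = 0"
    by (auto simp: student_t_def emeasure_density nn_integral_0_iff_AE split: split_indicator)
  then show ?thesis
    by (simp add: isCont_cdf measure_def)
qed

lemma student_t_cdf_pos:
  assumes v: "0 < v"
  shows "0 < student_t_cdf v x"
proof -
  interpret finite_borel_measure "student_t v"
    by (rule finite_borel_measure_student_t[OF v])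
  have "emeasure (student_t v) {..x} \<noteq> 0"
  proof
    assume "emeasure (student_t v) {..x} = 0"
    then have "AE y in lborel. ennreal (student_t_density v y) * indicator {..x} y = 0"
      by (simp add: student_t_def emeasure_density nn_integral_0_iff_AE)
    moreover have "ennreal (student_t_density v y) \<noteq> 0" for y
      using student_t_density_pos[OF v, of y] by (simp add: ennreal_eq_0_iff)
    ultimately have "AE y in lborel. y \<notin> {..x}"
      by (auto split: split_indicator_asm elim!: eventually_mono)
    then have "emeasure lborel {..x} = 0"
      by (subst (asm) AE_iff_measurable[of "{..x}"]) auto
    then have "emeasure lborel {x - 1..x} = 0"
      using emeasure_mono[of "{x - 1..x}" "{..x}" lborel] by (auto simp: zero_less_iff_neq_zero)
    then show False by simp
  qed
  then show ?thesis
    by (auto simp: cdf_def emeasure_eq_measure less_le)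
qed

lemma borel_measurable_skew_t_density [measurable]:
  assumes v: "0 < v"
  shows "skew_t_density v \<beta> \<in> borel_measurable borel"
proof -
  have "continuous_on UNIV (student_t_cdf (v + 1))"
    using isCont_student_t_cdf[of "v + 1"] v by (simp add: continuous_at_imp_continuous_on)
  then have [measurable]: "student_t_cdf (v + 1) \<in> borel_measurable borel"
    by (rule borel_measurable_continuous_onI)
  show ?thesis
    unfolding skew_t_density_def by measurable
qed

text \<open>
  The skewing factor is bounded by a constant, so the Student law dominates the skew-t law.
\<close>

lemma finite_borel_measure_skew_t:
  assumes v: "0 < v"
  shows "finite_borel_measure (skew_t v \<beta>)"
proof (intro finite_borel_measure.intro finite_measureI finite_borel_measure_axioms.intro)
  note [measurable] = borel_measurable_skew_t_density[OF v]
  interpret t: finite_borel_measure "student_t v"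
    by (rule finite_borel_measure_student_t[OF v])
  interpret t1: finite_borel_measure "student_t (v + 1)"
    using v by (intro finite_borel_measure_student_t) simp
  let ?m = "measure (student_t (v + 1)) (space (student_t (v + 1)))"
  show "sets (skew_t v \<beta>) = sets borel" by (simp add: skew_t_def)
  have "skew_t_density v \<beta> y \<le> (2 * ?m) * student_t_density v y" for y
    using mult_left_mono[OF t1.cdf_bounded, of "2 * student_t_density v y"]
      student_t_density_pos[OF v, of y]
    by (simp add: skew_t_density_def mult_ac)
  then have "emeasure (skew_t v \<beta>) (space (skew_t v \<beta>))
      \<le> (\<integral>\<^sup>+y. ennreal (2 * ?m) * ennreal (student_t_density v y) \<partial>lborel)"
    using student_t_density_pos[OF v]
    by (auto simp: skew_t_def emeasure_density ennreal_mult[symmetric] less_imp_le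
        intro!: nn_integral_mono ennreal_leI)
  also have "\<dots> = ennreal (2 * ?m) * emeasure (student_t v) (space (student_t v))"
    by (simp add: nn_integral_cmult student_t_def emeasure_density)
  also have "\<dots> < \<infinity>"
    using t.emeasure_finite[of "space (student_t v)"]
    by (auto simp: ennreal_mult_less_top less_top simp del: t.emeasure_finite)
  finally show "emeasure (skew_t v \<beta>) (space (skew_t v \<beta>)) \<noteq> \<infinity>" by simp
qed

text \<open>
  Dividing by \<open>y\<^sup>2\<close> under the root shows that the argument of the skewing factor tends to
  \<open>\<beta> * sqrt (v + 1)\<close>; continuity of the Student distribution function does the rest.
\<close>

lemma skew_t_density_asymp:
  assumes v: "0 < v"
  shows "((\<lambda>y. y powr (v + 1) * skew_t_density v \<beta> y)
           \<longlongrightarrow> 2 * (student_t_const v * v powr ((v + 1) / 2)) * student_t_cdf (v + 1) (\<beta> * sqrt (v + 1))) at_top"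
proof -
  have "((\<lambda>y::real. v / y\<^sup>2) \<longlongrightarrow> 0) at_top"
    by real_asymp
  then have "((\<lambda>y. \<beta> * sqrt ((v + 1) / (1 + v / y\<^sup>2))) \<longlongrightarrow> \<beta> * sqrt ((v + 1) / (1 + 0))) at_top"
    by (intro tendsto_intros) auto
  moreover have "\<forall>\<^sub>F y in at_top. \<beta> * sqrt ((v + 1) / (1 + v / y\<^sup>2)) = \<beta> * y * sqrt ((v + 1) / (y\<^sup>2 + v))"
    using eventually_gt_at_top[of 0]
  proof eventually_elim
    fix y :: real assume y: "0 < y"
    have "(v + 1) / (1 + v / y\<^sup>2) = y\<^sup>2 * ((v + 1) / (y\<^sup>2 + v))"
      using y v by (simp add: field_simps)
    then show "\<beta> * sqrt ((v + 1) / (1 + v / y\<^sup>2)) = \<beta> * y * sqrt ((v + 1) / (y\<^sup>2 + v))"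
      using y by (simp only: real_sqrt_mult) simp
  qed
  ultimately have "((\<lambda>y. \<beta> * y * sqrt ((v + 1) / (y\<^sup>2 + v))) \<longlongrightarrow> \<beta> * sqrt (v + 1)) at_top"
    by (simp add: tendsto_cong)
  then have "((\<lambda>y. student_t_cdf (v + 1) (\<beta> * y * sqrt ((v + 1) / (y\<^sup>2 + v))))
      \<longlongrightarrow> student_t_cdf (v + 1) (\<beta> * sqrt (v + 1))) at_top"
    using v by (intro isCont_tendsto_compose[OF isCont_student_t_cdf]) auto
  from tendsto_mult[OF tendsto_mult[OF tendsto_const[of 2] student_t_density_asymp[OF v]] this]
  show ?thesis
    by (simp add: skew_t_density_def mult_ac)
qed

text \<open>
  The limit of \<open>x powr v\<close> times the mass of the skew-t law above \<open>x\<close>. The exponent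
  \<open>(v - 1) / 2\<close> arises from \<open>v powr ((v + 1) / 2)\<close> in the density after division by \<open>v\<close>
  on integration.
\<close>

definition skew_t_tail_const :: "real \<Rightarrow> real \<Rightarrow> real" where
  "skew_t_tail_const v \<beta> =
     2 * student_t_const v * student_t_cdf (v + 1) (\<beta> * sqrt (v + 1)) * v powr ((v - 1) / 2)"

lemma skew_t_tail_const_pos: "0 < v \<Longrightarrow> 0 < skew_t_tail_const v \<beta>"
  using student_t_const_pos[of v] student_t_cdf_pos[of "v + 1"]
  by (simp add: skew_t_tail_const_def)

lemma skew_t_tail_asymp:
  assumes v: "0 < v"
  shows "((\<lambda>x. x powr v * measure (skew_t v \<beta>) {x<..}) \<longlongrightarrow> skew_t_tail_const v \<beta>) at_top"
proof -
  let ?K = "2 * (student_t_const v * v powr ((v + 1) / 2)) * student_t_cdf (v + 1) (\<beta> * sqrt (v + 1))"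
  have "0 \<le> ?K"
    using student_t_const_pos[OF v] student_t_cdf_pos[of "v + 1"] v by (simp add: less_imp_le)
  then have "((\<lambda>x. x powr v * measure (skew_t v \<beta>) {x<..}) \<longlongrightarrow> ?K / v) at_top"
    unfolding skew_t_def
    by (rule density_tail_asymp[OF borel_measurable_skew_t_density[OF v] v _ skew_t_density_asymp[OF v]])
  moreover have "v powr ((v + 1) / 2) = v * v powr ((v - 1) / 2)"
    using v powr_add[of v 1 "(v - 1) / 2"] by (simp add: field_simps)
  ultimately show ?thesis
    using v by (simp add: skew_t_tail_const_def mult_ac)
qed

section \<open>The tail of the mixture\<close>

text \<open>
  The assumed limit 1 says that the total masses of the components, weighted by \<open>p\<close>, add up
  to 1; complementing each component then gives the formula.
\<close>

lemma mixed_skew_t_survival: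
  assumes v: "\<And>i. i \<in> {1..r} \<Longrightarrow> 0 < v i"
    and lim: "(mixed_skew_t_cdf r v \<beta> p \<longlongrightarrow> 1) at_top"
  shows "1 - mixed_skew_t_cdf r v \<beta> p x = (\<Sum>i = 1..r. p i * measure (skew_t (v i) (\<beta> i)) {x<..})"
proof -
  let ?m = "\<lambda>i. measure (skew_t (v i) (\<beta> i)) (space (skew_t (v i) (\<beta> i)))"
  have "(mixed_skew_t_cdf r v \<beta> p \<longlongrightarrow> (\<Sum>i = 1..r. p i * ?m i)) at_top"
    unfolding mixed_skew_t_cdf_def
    by (intro tendsto_sum tendsto_mult tendsto_const
        finite_borel_measure.cdf_lim_at_top finite_borel_measure_skew_t v)
  then have one: "(\<Sum>i = 1..r. p i * ?m i) = 1"
    using lim by (rule tendsto_unique[OF trivial_limit_at_top_linorder])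
  have "measure (skew_t (v i) (\<beta> i)) {x<..} = ?m i - skew_t_cdf (v i) (\<beta> i) x" if "i \<in> {1..r}" for i
  proof -
    interpret finite_borel_measure "skew_t (v i) (\<beta> i)"
      by (rule finite_borel_measure_skew_t[OF v[OF that]])
    have "{x<..} = space (skew_t (v i) (\<beta> i)) - {..x}"
      by (auto simp: borel_UNIV)
    then show ?thesis
      by (simp add: cdf_def finite_measure_compl sets_M)
  qed
  then have "(\<Sum>i = 1..r. p i * measure (skew_t (v i) (\<beta> i)) {x<..})
      = (\<Sum>i = 1..r. p i * (?m i - skew_t_cdf (v i) (\<beta> i) x))"
    by simp
  then show ?thesis
    by (simp add: mixed_skew_t_cdf_def right_diff_distrib sum_subtractf one del: One_nat_def)
qed

text \<open>
  For \<open>i \<noteq> 1\<close> the scaled tail is \<open>x powr (- (v i - v 1))\<close> times a convergent function, and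
  hence negligible.
\<close>

lemma mixed_skew_t_tail_asymp:
  assumes r: "1 \<le> r" and v: "\<And>i. i \<in> {1..r} \<Longrightarrow> 0 < v i" and mono: "strict_mono_on {1..r} v"
    and lim: "(mixed_skew_t_cdf r v \<beta> p \<longlongrightarrow> 1) at_top"
  shows "((\<lambda>x. x powr v 1 * (1 - mixed_skew_t_cdf r v \<beta> p x))
           \<longlongrightarrow> p 1 * skew_t_tail_const (v 1) (\<beta> 1)) at_top"
proof -
  let ?S = "\<lambda>i x. measure (skew_t (v i) (\<beta> i)) {x<..}"
  have "((\<lambda>x. p i * (x powr v 1 * ?S i x))
      \<longlongrightarrow> (if i = 1 then p 1 * skew_t_tail_const (v 1) (\<beta> 1) else 0)) at_top"
    if i: "i \<in> {1..r}" for i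
  proof (cases "i = 1")
    case True
    then show ?thesis
      using tendsto_mult_left[OF skew_t_tail_asymp[OF v[OF i], of "\<beta> i"], of "p i"] by simp
  next
    case False
    then have "v 1 < v i"
      using i r by (intro strict_mono_onD[OF mono]) auto
    then have "((\<lambda>x. x powr - (v i - v 1)) \<longlongrightarrow> 0) at_top"
      by (intro tendsto_neg_powr filterlim_ident) auto
    from tendsto_mult_left[OF tendsto_mult[OF this skew_t_tail_asymp[OF v[OF i], of "\<beta> i"]], of "p i"]
    have "((\<lambda>x. p i * (x powr v 1 * ?S i x)) \<longlongrightarrow> 0) at_top"
      by (simp add: powr_add[symmetric] flip: mult.assoc)
    with False show ?thesis by simp
  qed
  then have "((\<lambda>x. \<Sum>i = 1..r. p i * (x powr v 1 * ?S i x))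
      \<longlongrightarrow> (\<Sum>i = 1..r. if i = 1 then p 1 * skew_t_tail_const (v 1) (\<beta> 1) else 0)) at_top"
    by (intro tendsto_sum)
  moreover have "(\<Sum>i = 1..r. p i * (x powr v 1 * ?S i x))
      = x powr v 1 * (1 - mixed_skew_t_cdf r v \<beta> p x)" for x
    using mixed_skew_t_survival[of r v \<beta> p x] v lim
    by (simp add: sum_distrib_left mult.left_commute del: One_nat_def)
  ultimately show ?thesis
    using r by simp
qed

section \<open>Maxima of independent variables with a regularly varying tail\<close>

text \<open>
  The exponential limit with a convergent sequence in place of a constant. On taking logarithms, the
  error of \<open>ln (1 + u) \<approx> u\<close> is at most \<open>2 * u\<^sup>2\<close>, which at \<open>u = z n / n\<close> is still
  small after multiplication by \<open>n\<close>.
\<close>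

lemma tendsto_one_plus_div_power_exp:
  fixes z :: "nat \<Rightarrow> real"
  assumes z: "z \<longlonglongrightarrow> c"
  shows "(\<lambda>n. (1 + z n / real n) ^ n) \<longlonglongrightarrow> exp c"
proof -
  have inv: "(\<lambda>n. 1 / real n) \<longlonglongrightarrow> 0" by real_asymp
  have u: "(\<lambda>n. z n / real n) \<longlonglongrightarrow> 0"
    using tendsto_mult[OF z inv] by simp
  have small: "\<forall>\<^sub>F n in sequentially. \<bar>z n / real n\<bar> < 1 / 2"
    using tendstoD[OF u, of "1 / 2"] by (simp add: dist_real_def)
  have "(\<lambda>n. real n * ln (1 + z n / real n) - z n) \<longlonglongrightarrow> 0"
  proof (rule Lim_null_comparison)
    show "\<forall>\<^sub>F n in sequentially. norm (real n * ln (1 + z n / real n) - z n)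
        \<le> 2 * (z n * z n) * (1 / real n)"
      using small eventually_gt_at_top[of 0]
    proof eventually_elim
      case (elim n)
      have "real n * ln (1 + z n / real n) - z n = real n * (ln (1 + z n / real n) - z n / real n)"
        using elim by (simp add: field_simps)
      then have "norm (real n * ln (1 + z n / real n) - z n)
          = real n * \<bar>ln (1 + z n / real n) - z n / real n\<bar>"
        by (simp add: abs_mult)
      also have "\<dots> \<le> real n * (2 * (z n / real n)\<^sup>2)"
        using elim by (intro mult_left_mono abs_ln_one_plus_x_minus_x_bound) auto
      also have "\<dots> = 2 * (z n * z n) * (1 / real n)"
        using elim by (simp add: field_simps power2_eq_square)
      finally show ?case .
    qed
    show "(\<lambda>n. 2 * (z n * z n) * (1 / real n)) \<longlonglongrightarrow> 0"
      using tendsto_mult[OF tendsto_mult[OF tendsto_const[of 2] tendsto_mult[OF z z]] inv] by simp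
  qed
  from tendsto_add[OF this z]
  have "(\<lambda>n. exp (real n * ln (1 + z n / real n))) \<longlonglongrightarrow> exp c"
    by (intro tendsto_exp) simp
  moreover have "\<forall>\<^sub>F n in sequentially. exp (real n * ln (1 + z n / real n)) = (1 + z n / real n) ^ n"
    using small
  proof eventually_elim
    case (elim n)
    then have "0 < 1 + z n / real n" by linarith
    then show ?case by (simp add: exp_of_nat_mult)
  qed
  ultimately show ?thesis
    by (simp add: tendsto_cong)
qed

text \<open>
  The normalization is chosen so that \<open>n * (1 - F (b * x))\<close>, the expected number of exceedances
  of the level \<open>b * x\<close> with \<open>b = (A * n) powr (1 / v)\<close>, converges to \<open>x powr (- v)\<close>.
\<close>

lemma powr_tail_imp_Frechet_limit:
  fixes F :: "real \<Rightarrow> real"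
  assumes v: "0 < v" and A: "0 < A" and x: "0 < x"
    and tail: "((\<lambda>y. y powr v * (1 - F y)) \<longlongrightarrow> A) at_top"
  shows "(\<lambda>n. F ((A * real n) powr (1 / v) * x) ^ n) \<longlonglongrightarrow> exp (- (x powr (- v)))"
proof -
  define b where "b n = (A * real n) powr (1 / v) * x" for n
  have "filterlim b at_top sequentially"
    unfolding b_def using A v x by real_asymp
  from filterlim_compose[OF tail this]
  have "(\<lambda>n. b n powr v * (1 - F (b n)) / (A * x powr v)) \<longlonglongrightarrow> A / (A * x powr v)"
    using A x by (intro tendsto_divide) auto
  moreover have "\<forall>\<^sub>F n in sequentially. b n powr v * (1 - F (b n)) / (A * x powr v)
      = real n * (1 - F (b n))"
    using eventually_gt_at_top[of 0]
  proof eventually_elim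
    case (elim n)
    have "b n powr v = A * real n * x powr v"
      using A v x by (simp add: b_def powr_mult powr_powr)
    then show ?case using A x by simp
  qed
  ultimately have "(\<lambda>n. real n * (1 - F (b n))) \<longlonglongrightarrow> x powr (- v)"
    using A by (simp add: tendsto_cong powr_minus inverse_eq_divide)
  then have "(\<lambda>n. (1 + - (real n * (1 - F (b n))) / real n) ^ n) \<longlonglongrightarrow> exp (- (x powr (- v)))"
    by (intro tendsto_one_plus_div_power_exp tendsto_minus)
  moreover have "\<forall>\<^sub>F n in sequentially. (1 + - (real n * (1 - F (b n))) / real n) ^ n = F (b n) ^ n"
    using eventually_gt_at_top[of 0] by eventually_elim simp
  ultimately show ?thesis
    by (simp add: tendsto_cong b_def)
qed

lemma (in prob_space) prob_Max_le:
  fixes T :: "nat \<Rightarrow> 'a \<Rightarrow> real"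
  assumes indep: "indep_vars (\<lambda>_. borel) T {1..}"
    and ident: "\<And>k. 1 \<le> k \<Longrightarrow> cdf (distr M borel (T k)) = F"
    and n: "1 \<le> n"
  shows "prob {\<omega> \<in> space M. Max ((\<lambda>k. T k \<omega>) ` {1..n}) \<le> t} = F t ^ n"
proof -
  have rv [measurable]: "random_variable borel (T k)" if "1 \<le> k" for k
    using indep that by (auto simp: indep_vars_def)
  have "{\<omega> \<in> space M. Max ((\<lambda>k. T k \<omega>) ` {1..n}) \<le> t} = (\<Inter>k\<in>{1..n}. T k -` {..t} \<inter> space M)"
    using n by (auto simp: Max_le_iff)
  also have "prob \<dots> = (\<Prod>k\<in>{1..n}. prob (T k -` {..t} \<inter> space M))"
    using n by (intro indep_varsD[OF indep]) auto
  also have "\<dots> = (\<Prod>k\<in>{1..n}. F t)"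
  proof (rule prod.cong)
    fix k assume "k \<in> {1..n}"
    then have k: "1 \<le> k" by simp
    then show "prob (T k -` {..t} \<inter> space M) = F t"
      using rv[OF k] by (simp add: cdf_def measure_distr flip: ident[OF k])
  qed simp
  finally show ?thesis by simp
qed

theorem proposition2p1:
  fixes M :: "'a measure" and T :: "nat \<Rightarrow> 'a \<Rightarrow> real"
    and r :: nat and v \<beta> p :: "nat \<Rightarrow> real"
    and F :: "real \<Rightarrow> real" and a :: "nat \<Rightarrow> real" and x :: real
  assumes r: "1 \<le> r"
    and v_pos: "\<And>i. i \<in> {1..r} \<Longrightarrow> 0 < v i"
    and v_mono: "strict_mono_on {1..r} v"
    and p_pos: "\<And>i. i \<in> {1..r} \<Longrightarrow> 0 < p i"
    and p_sum: "(\<Sum>i = 1..r. p i) = 1"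
    and F: "F = mixed_skew_t_cdf r v \<beta> p"
    and M: "prob_space M"
    and indep: "prob_space.indep_vars M (\<lambda>_. borel) T {1..}"
    and ident: "\<And>k. 1 \<le> k \<Longrightarrow> cdf (distr M borel (T k)) = F"
    and a: "\<And>n. 1 \<le> n \<Longrightarrow> a n =
      (2 * p 1 * student_t_const (v 1) * student_t_cdf (v 1 + 1) (\<beta> 1 * sqrt (v 1 + 1)))
          powr (1 / v 1)
        * v 1 powr ((v 1 - 1) / (2 * v 1))
        * real n powr (1 / v 1)"
    and x: "0 < x"
  shows "(\<lambda>n. measure M {\<omega> \<in> space M. Max ((\<lambda>k. T k \<omega>) ` {1..n}) \<le> a n * x})
           \<longlonglongrightarrow> exp (- (x powr (- v 1)))
       \<and> (\<lambda>n. F (a n * x) ^ n) \<longlonglongrightarrow> exp (- (x powr (- v 1)))"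
proof -
  interpret prob_space M by (rule M)
  have one: "1 \<in> {1..r}" using r by simp
  have v1: "0 < v 1" by (rule v_pos[OF one])
  have "random_variable borel (T 1)"
    using indep by (auto simp: indep_vars_def)
  then interpret law: real_distribution "distr M borel (T 1)"
    by (rule real_distribution_distr)
  have F_lim: "(F \<longlongrightarrow> 1) at_top"
    using law.cdf_lim_at_top_prob by (simp add: ident)
  define A where "A = p 1 * skew_t_tail_const (v 1) (\<beta> 1)"
  have A: "0 < A"
    using p_pos[OF one] skew_t_tail_const_pos[OF v1] by (simp add: A_def)
  have "((\<lambda>y. y powr v 1 * (1 - F y)) \<longlongrightarrow> A) at_top"
    using mixed_skew_t_tail_asymp[OF r v_pos v_mono] F_lim by (simp add: F A_def)
  from powr_tail_imp_Frechet_limit[OF v1 A x this]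
  have "(\<lambda>n. F ((A * real n) powr (1 / v 1) * x) ^ n) \<longlonglongrightarrow> exp (- (x powr (- v 1)))" .
  moreover have a_eq: "a n = (A * real n) powr (1 / v 1)" if "1 \<le> n" for n
  proof -
    let ?B = "2 * p 1 * student_t_const (v 1) * student_t_cdf (v 1 + 1) (\<beta> 1 * sqrt (v 1 + 1))"
    have "A * real n = ?B * v 1 powr ((v 1 - 1) / 2) * real n"
      by (simp add: A_def skew_t_tail_const_def)
    then have "(A * real n) powr (1 / v 1)
        = ?B powr (1 / v 1) * v 1 powr ((v 1 - 1) / 2 * (1 / v 1)) * real n powr (1 / v 1)"
      by (simp only: powr_mult powr_powr)
    then show ?thesis
      by (simp only: a[OF that]) simp
  qed
  have "\<forall>\<^sub>F n in sequentially. F ((A * real n) powr (1 / v 1) * x) ^ n = F (a n * x) ^ n"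
    using eventually_ge_at_top[of 1] by eventually_elim (simp add: a_eq)
  ultimately have pow: "(\<lambda>n. F (a n * x) ^ n) \<longlonglongrightarrow> exp (- (x powr (- v 1)))"
    by (simp add: tendsto_cong)
  have "\<forall>\<^sub>F n in sequentially. F (a n * x) ^ n = prob {\<omega> \<in> space M. Max ((\<lambda>k. T k \<omega>) ` {1..n}) \<le> a n * x}"
    using eventually_ge_at_top[of 1] by eventually_elim (rule prob_Max_le[OF indep ident, symmetric])
  with pow show ?thesis
    by (simp add: tendsto_cong)
qed

end
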